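(* Let $n\ge 1$, let $Q=\{x\in\mathbb{R}^n:\|x\|_2\le 1\}$ be the unit Euclidean ball, let $\xi$ be a random vector uniformly distributed over $Q$, and let $g(x)=x_1$ for $x\in Q$ (so the true maximum of $g$ on $Q$ is $1$). Let $p\in(0,1)$ and $\delta\in(0,1)$. Then the minimal sample size $N_{\min}$ that guarantees, with probability at least $p$, that the empirical maximum of $g$ is an at least $\delta$-accurate estimate of the true maximum is $$ N_{\min}=\left\lceil\frac{\ln(1-p)}{\ln\Bigl[\frac12+\frac12 I\bigl((1-\delta)^2;\frac12,\frac{n+1}{2}\bigr)\Bigr]}\right\rceil . $$
   Context: For a positive integer $N$, let $\xi^{(1)},\dots,\xi^{(N)}$ be independent copies of $\xi$ (a multisample of size $N$). The empirical maximum is $\eta=\max_{1\le i\le N} g(\xi^{(i)})$. With $\eta^*=\max_{x\in Q}g(x)$ the true maximum, $\eta$ is an at least $\delta$-accurate estimate of $\eta^*$ if $(\eta^*-\eta)/\eta^*\le\delta$. Thus $N_{\min}$ is the smallest positive integer $N$ for which this event has probability at least $p$. $I(x;a,b)=\frac{1}{B(a,b)}\int_0^x t^{a-1}(1-t)^{b-1}\,dt$, $0\le x\le 1$, is the regularized incomplete beta function, where $B(a,b)$ is the beta function. *)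

theory Defs
  imports "HOL-Probability.Probability"
begin

(* The integral is a Henstock-Kurzweil integral; since 0 powr c = 0, the integrand has the
   value 0 at a singular end point, which does not affect the integral. *)
definition reg_inc_beta :: "real \<Rightarrow> real \<Rightarrow> real \<Rightarrow> real" where
  "reg_inc_beta x a b =
     1 / Beta a b * integral {0..x} (\<lambda>t. t powr (a - 1) * (1 - t) powr (b - 1))"

definition uniform_on :: "'w measure \<Rightarrow> 'b::euclidean_space set \<Rightarrow> ('w \<Rightarrow> 'b) \<Rightarrow> bool" where
  "uniform_on M Q \<xi> \<longleftrightarrow>
     \<xi> \<in> borel_measurable M \<and> distr M borel \<xi> = uniform_measure lborel Q"

(* X 1, ..., X N are independent copies of \<xi>; indep_vars includes their measurability. *)
definition multisample ::
    "'w measure \<Rightarrow> ('w \<Rightarrow> 'b::topological_space) \<Rightarrow> nat \<Rightarrow> (nat \<Rightarrow> 'w \<Rightarrow> 'b) \<Rightarrow> bool" where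
  "multisample M \<xi> N X \<longleftrightarrow>
     prob_space.indep_vars M (\<lambda>_. borel) X {1..N} \<and>
     (\<forall>i\<in>{1..N}. distr M borel (X i) = distr M borel \<xi>)"

definition empirical_max :: "('b \<Rightarrow> real) \<Rightarrow> nat \<Rightarrow> (nat \<Rightarrow> 'w \<Rightarrow> 'b) \<Rightarrow> 'w \<Rightarrow> real" where
  "empirical_max g N X \<omega> = Max ((\<lambda>i. g (X i \<omega>)) ` {1..N})"

definition true_max :: "('b \<Rightarrow> real) \<Rightarrow> 'b set \<Rightarrow> real" where
  "true_max g Q = (GREATEST y. y \<in> g ` Q)"

definition accurate :: "real \<Rightarrow> real \<Rightarrow> real \<Rightarrow> bool" where
  "accurate \<delta> \<eta>' \<eta> \<longleftrightarrow> (\<eta>' - \<eta>) / \<eta>' \<le> \<delta>"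

(* The sample of size N is the family X N 1, ..., X N N, so that samples of different sizes
   need not be nested. *)
definition sufficient_size ::
    "'w measure \<Rightarrow> ('b \<Rightarrow> real) \<Rightarrow> 'b set \<Rightarrow> (nat \<Rightarrow> nat \<Rightarrow> 'w \<Rightarrow> 'b) \<Rightarrow> real \<Rightarrow> real \<Rightarrow> nat \<Rightarrow> bool" where
  "sufficient_size M g Q X p \<delta> N \<longleftrightarrow>
     N \<ge> 1 \<and>
     measure M {\<omega> \<in> space M. accurate \<delta> (true_max g Q) (empirical_max g N (X N) \<omega>)} \<ge> p"

definition N_min ::
    "'w measure \<Rightarrow> ('b \<Rightarrow> real) \<Rightarrow> 'b set \<Rightarrow> (nat \<Rightarrow> nat \<Rightarrow> 'w \<Rightarrow> 'b) \<Rightarrow> real \<Rightarrow> real \<Rightarrow> nat" where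
  "N_min M g Q X p \<delta> = (LEAST N. sufficient_size M g Q X p \<delta> N)"

end

theory Submission
  imports Defs
begin

text \<open>
  A sample of size \<open>N\<close> fails exactly when all its points have first coordinate below \<open>1 - \<delta>\<close>,
  which has probability \<open>F ^ N\<close> for \<open>F\<close> the probability that one point does; hence \<open>N\<close> suffices iff \<open>N \<ge> ln (1 - p) / ln F\<close>.
  By slicing the ball orthogonally to the coordinate axis, a slab of it has volume proportional
  to the integral of \<open>(1 - y\<^sup>2) powr ((n - 1) / 2)\<close>, so \<open>F = (J 1 + J (1 - \<delta>)) / (2 * J 1)\<close> where
  \<open>J c\<close> is the integral over \<open>{0..c}\<close>. The substitution \<open>y = sqrt t\<close> turns \<open>J c / J 1\<close> into
  \<open>I(c\<^sup>2; 1/2, (n + 1)/2)\<close>.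
\<close>

section \<open>Volumes of slices and slabs of the unit ball\<close>

text \<open>Tonelli with the coordinate along \<open>b\<close> as outer variable: the section at
  height \<open>y\<close> is a ball of radius \<open>sqrt (1 - y\<^sup>2)\<close> in one dimension
  less.\<close>

lemma emeasure_unit_cball_slice:
  fixes b :: "'a::euclidean_space"
  assumes b: "b \<in> Basis" and S [measurable]: "S \<in> sets borel"
  shows "emeasure lborel {x \<in> cball (0::'a) 1. x \<bullet> b \<in> S} =
    ennreal (unit_ball_vol (real (DIM('a) - 1))) *
      (\<integral>\<^sup>+y. ennreal (indicator (S \<inter> {-1..1}) y * sqrt (1 - y\<^sup>2) ^ (DIM('a) - 1)) \<partial>lborel)"
proof -
  interpret product_sigma_finite "\<lambda>_. lborel"
    by standard
  define A where "A = (Basis :: 'a set) - {b}"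
  have A: "finite A" "b \<notin> A" "insert b A = Basis" "card A = DIM('a) - 1"
    using b by (auto simp: A_def)
  define T where "T = {f \<in> space (Pi\<^sub>M (insert b A) (\<lambda>_. lborel)).
    sqrt (\<Sum>i\<in>insert b A. (f i)\<^sup>2) \<le> 1 \<and> f b \<in> S}"
  have T [measurable]: "T \<in> sets (Pi\<^sub>M (insert b A) (\<lambda>_. lborel))"
    unfolding T_def by measurable
  have slice_borel: "{x \<in> cball (0::'a) 1. x \<bullet> b \<in> S} \<in> sets borel"
    by measurable
  have "emeasure lborel {x \<in> cball (0::'a) 1. x \<bullet> b \<in> S} = emeasure (Pi\<^sub>M (insert b A) (\<lambda>_. lborel)) T"
  proof (subst lborel_eq, subst emeasure_distr)
    have "dist 0 (\<Sum>c\<in>Basis. f c *\<^sub>R c :: 'a) = sqrt (\<Sum>i\<in>Basis. (f i)\<^sup>2)" for f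
      by (subst euclidean_dist_l2) (auto simp: L2_set_def)
    then show "emeasure (Pi\<^sub>M Basis (\<lambda>_. lborel)) ((\<lambda>f. \<Sum>b\<in>Basis. f b *\<^sub>R b) -` {x \<in> cball (0::'a) 1. x \<bullet> b \<in> S} \<inter>
       space (Pi\<^sub>M Basis (\<lambda>_. lborel))) = emeasure (Pi\<^sub>M (insert b A) (\<lambda>_. lborel)) T"
      unfolding A(3) T_def using b by (intro arg_cong2[where f=emeasure]) (auto simp: cball_def)
  qed (use slice_borel in auto)
  also have "\<dots> = (\<integral>\<^sup>+f. indicator T f \<partial>Pi\<^sub>M (insert b A) (\<lambda>_. lborel))"
    by simp
  also have "\<dots> = (\<integral>\<^sup>+y. \<integral>\<^sup>+f. indicator T (f(b := y)) \<partial>Pi\<^sub>M A (\<lambda>_. lborel) \<partial>lborel)"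
    by (rule product_nn_integral_insert_rev[OF A(1,2) borel_measurable_indicator[OF T]])
  also have "\<dots> = (\<integral>\<^sup>+y. \<integral>\<^sup>+f. indicator (S \<inter> {-1..1}) y *
      indicator ({f. sqrt (\<Sum>i\<in>A. (f i)\<^sup>2) \<le> sqrt (1 - y\<^sup>2)} \<inter> space (Pi\<^sub>M A (\<lambda>_. lborel))) f
        \<partial>Pi\<^sub>M A (\<lambda>_. lborel) \<partial>lborel)"
  proof (intro nn_integral_cong)
    fix y :: real and f :: "'a \<Rightarrow> real"
    assume f: "f \<in> space (Pi\<^sub>M A (\<lambda>_. lborel))"
    have "(\<Sum>i\<in>A. ((f(b := y)) i)\<^sup>2) = (\<Sum>i\<in>A. (f i)\<^sup>2)"
      using A(2) by (intro sum.cong) auto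
    then have eq: "(\<Sum>i\<in>insert b A. ((f(b := y)) i)\<^sup>2) = y\<^sup>2 + (\<Sum>i\<in>A. (f i)\<^sup>2)"
      using A(1,2) by simp
    \<comment> \<open>The restriction to \<open>{-1..1}\<close> has to be made explicit:
      \<open>sqrt\<close> is negative on negative arguments, so an even power of
      \<open>sqrt (1 - y\<^sup>2)\<close> would be positive outside the ball.\<close>
    have y: "y \<in> {-1..1}" if "y\<^sup>2 + (\<Sum>i\<in>A. (f i)\<^sup>2) \<le> 1"
    proof -
      have "y\<^sup>2 \<le> 1"
        using that sum_nonneg[of A "\<lambda>i. (f i)\<^sup>2"] by simp
      then show ?thesis
        by (simp add: abs_square_le_1 abs_le_iff)
    qed
    have sp: "f(b := y) \<in> space (Pi\<^sub>M (insert b A) (\<lambda>_. lborel))"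
      using f by (auto simp: space_PiM PiE_def extensional_def)
    have "f(b := y) \<in> T \<longleftrightarrow> y \<in> S \<and> y\<^sup>2 + (\<Sum>i\<in>A. (f i)\<^sup>2) \<le> 1"
      using sp unfolding T_def mem_Collect_eq eq by auto
    also have "\<dots> \<longleftrightarrow> y \<in> S \<inter> {-1..1} \<and> sqrt (\<Sum>i\<in>A. (f i)\<^sup>2) \<le> sqrt (1 - y\<^sup>2)"
      using y by auto
    finally show "indicator T (f(b := y)) = (indicator (S \<inter> {-1..1}) y *
      indicator ({f. sqrt (\<Sum>i\<in>A. (f i)\<^sup>2) \<le> sqrt (1 - y\<^sup>2)} \<inter> space (Pi\<^sub>M A (\<lambda>_. lborel))) f :: ennreal)"
      using f by (simp add: indicator_def)
  qed
  also have "\<dots> = (\<integral>\<^sup>+y. indicator (S \<inter> {-1..1}) y * emeasure (Pi\<^sub>M A (\<lambda>_. lborel))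
      ({f. sqrt (\<Sum>i\<in>A. (f i)\<^sup>2) \<le> sqrt (1 - y\<^sup>2)} \<inter> space (Pi\<^sub>M A (\<lambda>_. lborel))) \<partial>lborel)"
    using A(1) by (intro nn_integral_cong, subst nn_integral_cmult) (auto simp: nn_integral_indicator)
  also have "\<dots> = (\<integral>\<^sup>+y. ennreal (unit_ball_vol (real (card A))) *
      ennreal (indicator (S \<inter> {-1..1}) y * sqrt (1 - y\<^sup>2) ^ card A) \<partial>lborel)"
  proof (intro nn_integral_cong_AE)
    \<comment> \<open>At these two heights the section has radius 0, whereas
      \<open>emeasure_cball_aux\<close> is for positive radii.\<close>
    have "AE y in lborel. y \<notin> {-1, 1::real}"
      by (intro AE_not_in countable_imp_null_set_lborel) auto
    then show "AE y in lborel. indicator (S \<inter> {-1..1}) y * emeasure (Pi\<^sub>M A (\<lambda>_. lborel))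
      ({f. sqrt (\<Sum>i\<in>A. (f i)\<^sup>2) \<le> sqrt (1 - y\<^sup>2)} \<inter> space (Pi\<^sub>M A (\<lambda>_. lborel))) =
      ennreal (unit_ball_vol (real (card A))) *
        ennreal (indicator (S \<inter> {-1..1}) y * sqrt (1 - y\<^sup>2) ^ card A)"
    proof eventually_elim
      case (elim y)
      show ?case
      proof (cases "y \<in> {-1<..<1}")
        case True
        then have "y\<^sup>2 < 1"
          by (simp add: abs_square_less_1 abs_less_iff)
        then show ?thesis
          using A(1) by (subst emeasure_cball_aux) (auto simp: indicator_def ennreal_mult')
      qed (use elim in auto)
    qed
  qed
  also have "\<dots> = ennreal (unit_ball_vol (real (card A))) *
      (\<integral>\<^sup>+y. ennreal (indicator (S \<inter> {-1..1}) y * sqrt (1 - y\<^sup>2) ^ card A) \<partial>lborel)"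
    by (rule nn_integral_cmult) auto
  finally show ?thesis
    unfolding A(4) .
qed

lemma measure_unit_cball_slab:
  fixes b :: "'a::euclidean_space"
  assumes b: "b \<in> Basis" and c: "-1 \<le> c" "c \<le> 1"
  shows "measure lborel {x \<in> cball (0::'a) 1. x \<bullet> b < c} =
    unit_ball_vol (real (DIM('a) - 1)) * integral {-1..c} (\<lambda>y. sqrt (1 - y\<^sup>2) ^ (DIM('a) - 1))"
proof -
  let ?m = "DIM('a) - 1"
  let ?f = "\<lambda>y::real. sqrt (1 - y\<^sup>2) ^ ?m"
  have nonneg: "?f y \<ge> 0" if "y \<in> {-1..c}" for y
    using that c by (auto simp: abs_square_le_1 abs_le_iff)
  have int: "(?f has_integral integral {-1..c} ?f) {-1..c}"
    by (intro integrable_integral integrable_continuous_real continuous_intros)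
  have "emeasure lborel {x \<in> cball (0::'a) 1. x \<bullet> b \<in> {..<c}} =
      ennreal (unit_ball_vol (real ?m)) *
      (\<integral>\<^sup>+y. ennreal (indicator ({..<c} \<inter> {-1..1}) y * ?f y) \<partial>lborel)"
    by (rule emeasure_unit_cball_slice) (use b in auto)
  also have "(\<integral>\<^sup>+y. ennreal (indicator ({..<c} \<inter> {-1..1}) y * ?f y) \<partial>lborel) =
      (\<integral>\<^sup>+y. ennreal (indicator {-1..c} y * ?f y) \<partial>lborel)"
    \<comment> \<open>The two indicators differ at most at the single point
      \<open>c\<close>.\<close>
    using c by (intro nn_integral_cong_AE AE_I[of _ _ "{c}"]) (auto simp: indicator_def)
  also have "\<dots> = ennreal (integral {-1..c} ?f)"
    using nn_integral_has_integral_lebesgue[OF nonneg int]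
    by (simp add: mult.commute)
  finally show ?thesis
    using integral_nonneg[OF has_integral_integrable[OF int] nonneg]
    by (simp add: measure_def flip: ennreal_mult)
qed

section \<open>Slab integrals and the incomplete beta function\<close>

text \<open>This is \<open>J c\<close> of the overview with \<open>m = n - 1\<close>. A natural
  power of \<open>sqrt\<close> is continuous on the whole line, so integrability needs no side
  conditions.\<close>

definition cap_int :: "nat \<Rightarrow> real \<Rightarrow> real" where
  "cap_int m c = integral {0..c} (\<lambda>y. sqrt (1 - y\<^sup>2) ^ m)"

text \<open>The integrand is even, so the part over \<open>{-1..0}\<close> equals the one over
  \<open>{0..1}\<close>.\<close>

lemma integral_sqrt_power_split:
  assumes "0 \<le> c"
  shows "integral {-1..c} (\<lambda>y. sqrt (1 - y\<^sup>2) ^ m) = cap_int m 1 + cap_int m c"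
proof -
  let ?f = "\<lambda>y::real. sqrt (1 - y\<^sup>2) ^ m"
  have "integral {-1..0} ?f = integral {0..1} ?f"
    using Henstock_Kurzweil_Integration.integral_reflect_real[of 1 0 ?f]
    by (simp del: Henstock_Kurzweil_Integration.integral_reflect_real)
  moreover have "integral {-1..0} ?f + integral {0..c} ?f = integral {-1..c} ?f"
    using assms
    by (intro Henstock_Kurzweil_Integration.integral_combine integrable_continuous_real continuous_intros) auto
  ultimately show ?thesis
    by (simp add: cap_int_def)
qed

text \<open>Substitute \<open>y = sqrt t\<close>; the factor 2 absorbs the 1/2 in the derivative of
  \<open>sqrt\<close>. The parameter \<open>(m + 2) / 2\<close> is
  \<open>(n + 1) / 2\<close>.\<close>

lemma has_integral_cap_int:
  assumes c: "0 \<le> c" "c \<le> 1"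
  shows "((\<lambda>t. t powr (1/2 - 1) * (1 - t) powr ((real m + 2) / 2 - 1)) has_integral 2 * cap_int m c) {0..c\<^sup>2}"
proof -
  let ?f = "\<lambda>y::real. sqrt (1 - y\<^sup>2) ^ m"
  have "((\<lambda>s. (inverse (sqrt s) / 2) *\<^sub>R ?f (sqrt s)) has_integral integral {sqrt 0..sqrt (c\<^sup>2)} ?f) {0..c\<^sup>2}"
  \<comment> \<open>The exceptional set \<open>{0}\<close> is where \<open>sqrt\<close> is not
    differentiable.\<close>
  proof (rule has_integral_substitution_strong[where f = ?f and g = sqrt and s = "{0}" and c = 0 and d = 1])
    have "c\<^sup>2 \<le> 1"
      using c by (simp add: power_le_one)
    then show "sqrt ` {0..c\<^sup>2} \<subseteq> {0..1}"
      by auto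
    fix x assume "x \<in> {0..c\<^sup>2} - {0}"
    then show "(sqrt has_field_derivative inverse (sqrt x) / 2) (at x within {0..c\<^sup>2})"
      by (intro has_field_derivative_at_within[OF DERIV_real_sqrt]) auto
  qed (auto intro!: continuous_intros)
  then have "((\<lambda>s. 2 * (inverse (sqrt s) / 2 * ?f (sqrt s))) has_integral 2 * cap_int m c) {0..c\<^sup>2}"
    using c by (intro has_integral_mult_right) (simp add: cap_int_def)
  then show ?thesis
  \<comment> \<open>The integrands can differ at \<open>t = 1\<close>: for \<open>m = 0\<close>,
    \<open>0 ^ 0\<close> is 1 but \<open>0 powr 0\<close> is 0.\<close>
  proof (rule has_integral_spike_finite[where S = "{0, 1}", rotated 2])
    fix t assume "t \<in> {0..c\<^sup>2} - {0, 1}"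
    moreover have "c\<^sup>2 \<le> 1"
      using c by (simp add: power_le_one)
    ultimately have t: "0 < t" "t < 1"
      by auto
    have "sqrt (1 - t) ^ m = (1 - t) powr ((real m + 2) / 2 - 1)"
      using t by (simp add: powr_half_sqrt [symmetric] powr_realpow[symmetric] powr_powr add_divide_distrib)
    moreover have "inverse (sqrt t) = t powr (1/2 - 1)"
      using t by (simp add: powr_minus powr_half_sqrt)
    ultimately show "t powr (1/2 - 1) * (1 - t) powr ((real m + 2) / 2 - 1) =
        2 * (inverse (sqrt t) / 2 * ?f (sqrt t))"
      using t by simp
  qed auto
qed

text \<open>The case \<open>c = 1\<close> of the substitution evaluates \<open>Beta\<close> itself,
  so the factors 2 cancel.\<close>

lemma reg_inc_beta_half:
  assumes c: "0 \<le> c" "c \<le> 1"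
  shows "reg_inc_beta (c\<^sup>2) (1/2) ((real m + 2) / 2) = cap_int m c / cap_int m 1"
proof -
  have "Beta (1/2) ((real m + 2) / 2) = 2 * cap_int m 1"
    using has_integral_Beta_real[of "1/2" "(real m + 2) / 2"] has_integral_cap_int[of 1 m]
    by (auto intro: has_integral_unique)
  then show ?thesis
    using integral_unique[OF has_integral_cap_int[OF c, of m]] by (simp add: reg_inc_beta_def)
qed

lemma cap_int_strict_mono:
  assumes "0 \<le> c" "c < d" "d \<le> 1"
  shows "cap_int m c < cap_int m d"
proof -
  let ?f = "\<lambda>y::real. sqrt (1 - y\<^sup>2) ^ m"
  have pos: "0 < ?f y" if "y \<in> {c<..<d}" for y
    using that assms by (auto simp: abs_square_less_1 abs_less_iff)
  have cont: "continuous_on {c..d} ?f"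
    by (intro continuous_intros)
  have "integral {c..d} (\<lambda>_. 0) < integral {c..d} ?f"
    using assms(2) pos cont by (intro integral_less_real) auto
  moreover have "cap_int m c + integral {c..d} ?f = cap_int m d"
    unfolding cap_int_def using assms
    by (intro Henstock_Kurzweil_Integration.integral_combine integrable_continuous_real continuous_intros) auto
  ultimately show ?thesis
    by simp
qed

lemma cap_int_0 [simp]: "cap_int m 0 = 0"
  by (simp add: cap_int_def)

text \<open>Strict bounds put \<open>F\<close> strictly between 1/2 and 1, which makes
  \<open>ln F\<close> negative.\<close>

lemma reg_inc_beta_half_bounds:
  assumes c: "0 < c" "c < 1"
  shows "0 < reg_inc_beta (c\<^sup>2) (1/2) ((real m + 2) / 2)"
    and "reg_inc_beta (c\<^sup>2) (1/2) ((real m + 2) / 2) < 1"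
  using cap_int_strict_mono[of 0 c m] cap_int_strict_mono[of c 1 m] c
  by (simp_all add: reg_inc_beta_half)

section \<open>The uniform distribution on the ball\<close>

text \<open>The volume of the whole ball is also obtained from the slab formula, at height 1, so the
  constant \<open>unit_ball_vol m\<close> cancels and ball volumes in different dimensions need not
  be related.\<close>

lemma measure_uniform_cball_slab:
  fixes b :: "'a::euclidean_space"
  assumes b: "b \<in> Basis" and c: "0 \<le> c" "c \<le> 1"
  shows "measure (uniform_measure lborel (cball 0 1)) {x::'a. x \<bullet> b < c} =
    1/2 + 1/2 * reg_inc_beta (c\<^sup>2) (1/2) ((real DIM('a) + 1) / 2)"
proof -
  define m where "m = DIM('a) - 1"
  have DIM: "real DIM('a) + 1 = real m + 2"
    using DIM_positive[where 'a='a] by (simp add: m_def of_nat_diff)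
  have pos: "0 < cap_int m 1"
    using cap_int_strict_mono[of 0 1 m] by simp
  have slab: "measure lborel {x \<in> cball (0::'a) 1. x \<bullet> b < d} =
      unit_ball_vol (real m) * (cap_int m 1 + cap_int m d)" if "0 \<le> d" "d \<le> 1" for d
    using measure_unit_cball_slab[OF b, of d] integral_sqrt_power_split[of d m] that
    by (simp add: m_def)
  \<comment> \<open>The open slab at height 1 omits only points of the ball on a tangent hyperplane,
    a null set.\<close>
  have "measure lborel (cball (0::'a) 1) = measure lborel {x \<in> cball (0::'a) 1. x \<bullet> b < 1}"
  proof (rule measure_eq_AE)
    have "negligible {x::'a. b \<bullet> x = 1}"
      using b by (intro negligible_hyperplane) auto
    then have "{x::'a. b \<bullet> x = 1} \<in> null_sets lborel"
      by (auto simp: negligible_iff_null_sets null_sets_completion_iff closed_hyperplane)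
    then have "AE x in lborel. x \<notin> {x::'a. b \<bullet> x = 1}"
      by (rule AE_not_in)
    then show "AE x in lborel. (x \<in> cball (0::'a) 1) = (x \<in> {x \<in> cball (0::'a) 1. x \<bullet> b < 1})"
    proof eventually_elim
      case (elim x)
      have "x \<bullet> b \<le> norm x"
        using b Basis_le_norm[of b x] by simp
      then show ?case
        using elim by (auto simp: inner_commute)
    qed
  qed auto
  then have "measure lborel (cball (0::'a) 1) = unit_ball_vol (real m) * (2 * cap_int m 1)"
    using slab[of 1] by simp
  moreover have "measure (uniform_measure lborel (cball 0 1)) {x::'a. x \<bullet> b < c} =
      measure lborel (cball 0 1 \<inter> {x::'a. x \<bullet> b < c}) / measure lborel (cball (0::'a) 1)"
    using unit_ball_vol_pos[of "real DIM('a)"]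
    by (intro measure_uniform_measure) (auto simp: emeasure_cball simp del: unit_ball_vol_pos)
  moreover have "cball 0 1 \<inter> {x::'a. x \<bullet> b < c} = {x \<in> cball 0 1. x \<bullet> b < c}"
    by auto
  moreover have "unit_ball_vol (real m) \<noteq> 0"
    using unit_ball_vol_pos[of "real m"] by linarith
  ultimately have "measure (uniform_measure lborel (cball 0 1)) {x::'a. x \<bullet> b < c} =
      (cap_int m 1 + cap_int m c) / (2 * cap_int m 1)"
    using slab[OF c] by simp
  also have "\<dots> = 1/2 + 1/2 * (cap_int m c / cap_int m 1)"
    using pos by (simp add: add_divide_distrib)
  finally show ?thesis
    unfolding DIM reg_inc_beta_half[OF c] .
qed

section \<open>Sampling and the minimal sample size\<close>

lemma true_max_coordinate: "true_max (\<lambda>x::real^'n. x $ k) {x. norm x \<le> 1} = 1"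
  unfolding true_max_def
proof (rule Greatest_equality)
  show "1 \<in> (\<lambda>x::real^'n. x $ k) ` {x. norm x \<le> 1}"
    by (intro image_eqI[where x = "axis k 1"]) auto
  show "y \<le> 1" if y: "y \<in> (\<lambda>x::real^'n. x $ k) ` {x. norm x \<le> 1}" for y
  proof -
    obtain x :: "real^'n" where x: "norm x \<le> 1" "y = x $ k"
      using y by blast
    then show ?thesis
      using component_le_norm_cart[of x k] by linarith
  qed
qed

lemma (in prob_space) prob_all_samples_in:
  assumes ms: "multisample M \<xi> N X" and N: "N \<ge> 1" and A [measurable]: "A \<in> sets borel"
  shows "prob {\<omega> \<in> space M. \<forall>i\<in>{1..N}. X i \<omega> \<in> A} = measure (distr M borel \<xi>) A ^ N"
proof -
  have ind: "indep_vars (\<lambda>_. borel) X {1..N}"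
    and dist: "\<And>i. i \<in> {1..N} \<Longrightarrow> distr M borel (X i) = distr M borel \<xi>"
    using ms by (auto simp: multisample_def)
  \<comment> \<open>As \<open>N \<ge> 1\<close>, the intersection is over a nonempty family and so
    lies within \<open>space M\<close>.\<close>
  have "{\<omega> \<in> space M. \<forall>i\<in>{1..N}. X i \<omega> \<in> A} = (\<Inter>i\<in>{1..N}. X i -` A \<inter> space M)"
    using N by auto
  also have "prob \<dots> = (\<Prod>i\<in>{1..N}. prob (X i -` A \<inter> space M))"
    using N by (intro indep_varsD[OF ind]) auto
  also have "\<dots> = (\<Prod>i\<in>{1..N}. measure (distr M borel \<xi>) A)"
  proof (rule prod.cong[OF refl])
    fix i assume i: "i \<in> {1..N}"
    then have "X i \<in> borel_measurable M"
      using ind by (auto simp: indep_vars_def)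
    then show "prob (X i -` A \<inter> space M) = measure (distr M borel \<xi>) A"
      using measure_distr[of "X i" M borel A] dist[OF i] by simp
  qed
  finally show ?thesis
    by simp
qed

text \<open>Take logarithms in \<open>F ^ N \<le> 1 - p\<close> and divide by
  \<open>ln F < 0\<close>. The first conclusion ensures that \<open>LEAST\<close> ranges over a
  satisfiable predicate.\<close>

lemma Least_power_bound:
  fixes F p :: real
  assumes F: "0 < F" "F < 1" and p: "0 < p" "p < 1"
  defines "L \<equiv> \<lceil>ln (1 - p) / ln F\<rceil>"
  defines "P \<equiv> (\<lambda>N::nat. N \<ge> 1 \<and> 1 - F ^ N \<ge> p)"
  shows "P (nat L)" and "int (LEAST N. P N) = L"
proof -
  have neg: "ln F < 0" "ln (1 - p) < 0"
    using F p by auto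
  then have "0 < ln (1 - p) / ln F"
    by (simp add: divide_neg_neg)
  \<comment> \<open>Positivity makes \<open>N \<ge> 1\<close> follow from
    \<open>L \<le> int N\<close> and lets \<open>nat L\<close> convert back to
    \<open>L\<close>.\<close>
  then have L: "0 < L"
    by (simp add: L_def)
  have iff: "P N \<longleftrightarrow> L \<le> int N" for N
  proof -
    have "1 - F ^ N \<ge> p \<longleftrightarrow> F ^ N \<le> 1 - p"
      by auto
    also have "\<dots> \<longleftrightarrow> ln (F ^ N) \<le> ln (1 - p)"
      using F p by (subst ln_le_cancel_iff) auto
    also have "\<dots> \<longleftrightarrow> ln (1 - p) / ln F \<le> real N"
      using F neg by (simp add: ln_realpow neg_divide_le_eq)
    also have "\<dots> \<longleftrightarrow> L \<le> int N"
      by (simp add: L_def ceiling_le_iff)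
    finally show ?thesis
      using L by (auto simp: P_def)
  qed
  show "P (nat L)"
    using L by (simp add: iff)
  have "(LEAST N. P N) = nat L"
    using L by (intro Least_equality) (auto simp: iff)
  then show "int (LEAST N. P N) = L"
    using L by simp
qed

theorem theorem1:
  fixes M :: "'w measure"
    and \<xi> :: "'w \<Rightarrow> real ^ 'n"
    and X :: "nat \<Rightarrow> nat \<Rightarrow> 'w \<Rightarrow> real ^ 'n"
    and g :: "real ^ 'n \<Rightarrow> real"
    and Q :: "(real ^ 'n) set"
    and k :: 'n
    and p \<delta> :: real
  assumes "prob_space M"
    and "Q = {x. norm x \<le> 1}"
    and "uniform_on M Q \<xi>"
    and "\<And>N. N \<ge> 1 \<Longrightarrow> multisample M \<xi> N (X N)"
    and "g = (\<lambda>x. x $ k)"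
    and "0 < p" and "p < 1"
    and "0 < \<delta>" and "\<delta> < 1"
  shows "(\<exists>N. sufficient_size M g Q X p \<delta> N) \<and>
    int (N_min M g Q X p \<delta>) =
      \<lceil>ln (1 - p) / ln (1/2 + 1/2 * reg_inc_beta ((1 - \<delta>)^2) (1/2) ((real CARD('n) + 1) / 2))\<rceil>"
proof -
  interpret prob_space M by fact
  define F where "F = 1/2 + 1/2 * reg_inc_beta ((1 - \<delta>)^2) (1/2) ((real CARD('n) + 1) / 2)"
  \<comment> \<open>The failure region of one sample point, with \<open>x $ k\<close> written as an
    inner product with a basis vector to fit the slab lemma.\<close>
  define A where "A = {x::real^'n. x \<bullet> axis k 1 < 1 - \<delta>}"
  have A [measurable]: "A \<in> sets borel"
    unfolding A_def by measurable
  have Q: "Q = cball 0 1"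
    using assms(2) by (auto simp: cball_def)
  have CARD: "real CARD('n) + 1 = real (CARD('n) - 1) + 2"
    by (simp add: of_nat_diff)
  have F01: "0 < F" "F < 1"
    using reg_inc_beta_half_bounds[of "1 - \<delta>" "CARD('n) - 1"] assms(8,9)
    unfolding F_def CARD by linarith+
  have "axis k (1::real) \<in> Basis"
    by (simp add: axis_in_Basis_iff)
  then have F: "measure (distr M borel \<xi>) A = F"
    using assms(3,8,9) measure_uniform_cball_slab[of "axis k (1::real)" "1 - \<delta>"]
    by (simp add: uniform_on_def Q A_def F_def)
  have prob: "prob {\<omega> \<in> space M. accurate \<delta> (true_max g Q) (empirical_max g N (X N) \<omega>)} = 1 - F ^ N"
    if N: "N \<ge> 1" for N
  proof -
    let ?B = "{\<omega> \<in> space M. \<forall>i\<in>{1..N}. X N i \<omega> \<in> A}"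
    have ms: "multisample M \<xi> N (X N)"
      using assms(4) N by simp
    then have [measurable]: "i \<in> {1..N} \<Longrightarrow> X N i \<in> borel_measurable M" for i
      by (auto simp: multisample_def indep_vars_def)
    have "?B \<in> events"
      by measurable
    \<comment> \<open>As the true maximum is 1, accuracy means that the empirical maximum is at
      least \<open>1 - \<delta>\<close>.\<close>
    have "accurate \<delta> (true_max g Q) (empirical_max g N (X N) \<omega>) \<longleftrightarrow> \<not> (\<forall>i\<in>{1..N}. X N i \<omega> \<in> A)" for \<omega>
    proof -
      have "accurate \<delta> (true_max g Q) (empirical_max g N (X N) \<omega>) \<longleftrightarrow>
          \<not> Max ((\<lambda>i. X N i \<omega> $ k) ` {1..N}) < 1 - \<delta>"
        by (auto simp: accurate_def assms(2,5) true_max_coordinate empirical_max_def)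
      also have "\<dots> \<longleftrightarrow> \<not> (\<forall>i\<in>{1..N}. X N i \<omega> \<in> A)"
        using N by (subst Max_less_iff) (auto simp: A_def inner_axis)
      finally show ?thesis .
    qed
    then have "{\<omega> \<in> space M. accurate \<delta> (true_max g Q) (empirical_max g N (X N) \<omega>)} = space M - ?B"
      by auto
    then show ?thesis
      using prob_compl[OF \<open>?B \<in> events\<close>] prob_all_samples_in[OF ms N A] F by simp
  qed
  have "sufficient_size M g Q X p \<delta> = (\<lambda>N. N \<ge> 1 \<and> 1 - F ^ N \<ge> p)"
    by (rule ext) (auto simp: sufficient_size_def prob)
  then show ?thesis
    using Least_power_bound[OF F01 assms(6,7)] unfolding N_min_def F_def[symmetric] by auto
qed

end
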